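(* Let $\mathbb F_q$ be a finite field of characteristic $p$, let $S=\operatorname{Spec}\mathbb F_q$, and let $n\ge 1$. Let $b_0,b_1,\dots,b_n\in\mathbb F_q$ be pairwise distinct and such that $$\frac{b_i-b_0}{b_j-b_0}\in\mathbb F_p\qquad\text{for all } 1\le i,j\le n.$$ Let $C=(t+b_0,t+b_1,\dots,t+b_n)$ and $\Delta=(s,\dots,s)$ be the curves in $X_{n+1,S}=X(1)_S^{n+1}\cong(\mathbb P^1_S)^{n+1}$ parametrized by $t$ and by $s$ respectively. Then there are infinitely many points on $C$ isogenous to a point on $\Delta$.
   Context: $X(1)_S$ is the (proper, coarse) modular curve over $S$, identified with $\mathbb P^1_S$ via the $j$-invariant, and $X_{m,S}=X(1)^m_S$ is its $m$-fold fibre product over $S$, parametrizing products of $m$ (generalized) elliptic curves. Two points $x,y\in X_{m,S}$ are called isogenous if the corresponding semi-abelian varieties $A_x,A_y$ parametrized by $x,y$ are geometrically isogenous. *)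

theory Defs
  imports "HOL-Algebra.Algebraic_Closure_Type" "HOL-Library.FuncSet"
begin

record 'k weierstrass =
  wa1 :: 'k
  wa2 :: 'k
  wa3 :: 'k
  wa4 :: 'k
  wa6 :: 'k

text \<open>
  The coefficients describe the plane cubic
  \<open>y^2 z + a1 x y z + a3 y z^2 = x^3 + a2 x^2 z + a4 x z^2 + a6 z^3\<close>.
  The invariants below are the standard ones, valid in every characteristic.
\<close>

definition wb2 :: "'k::field weierstrass \<Rightarrow> 'k" where
  "wb2 W = wa1 W ^ 2 + 4 * wa2 W"

definition wb4 :: "'k::field weierstrass \<Rightarrow> 'k" where
  "wb4 W = 2 * wa4 W + wa1 W * wa3 W"

definition wb6 :: "'k::field weierstrass \<Rightarrow> 'k" where
  "wb6 W = wa3 W ^ 2 + 4 * wa6 W"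

definition wb8 :: "'k::field weierstrass \<Rightarrow> 'k" where
  "wb8 W = wa1 W ^ 2 * wa6 W + 4 * wa2 W * wa6 W - wa1 W * wa3 W * wa4 W
           + wa2 W * wa3 W ^ 2 - wa4 W ^ 2"

definition wc4 :: "'k::field weierstrass \<Rightarrow> 'k" where
  "wc4 W = wb2 W ^ 2 - 24 * wb4 W"

definition wdisc :: "'k::field weierstrass \<Rightarrow> 'k" where
  "wdisc W = - (wb2 W ^ 2 * wb8 W) - 8 * wb4 W ^ 3 - 27 * wb6 W ^ 2
             + 9 * wb2 W * wb4 W * wb6 W"

text \<open>
  The curve is smooth iff the discriminant is nonzero, and a nodal cubic iff the discriminant
  vanishes but \<open>c4\<close> does not; only cuspidal cubics are excluded.
\<close>

definition generalized_elliptic :: "'k::field weierstrass \<Rightarrow> bool" where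
  "generalized_elliptic W \<longleftrightarrow> wdisc W \<noteq> 0 \<or> wc4 W \<noteq> 0"

datatype 'k proj_line = Fin 'k | Infty

definition j_invariant :: "'k::field weierstrass \<Rightarrow> 'k proj_line" where
  "j_invariant W = (if wdisc W = 0 then Infty else Fin (wc4 W ^ 3 / wdisc W))"

text \<open>
  \<open>Origin\<close> is the point \<open>[0:1:0]\<close>, the unique point of the cubic on the line \<open>z = 0\<close>, and
  \<open>Affine x y\<close> is \<open>[x:y:1]\<close>.
\<close>

datatype 'k wpoint = Origin | Affine 'k 'k

definition on_curve :: "'k::field weierstrass \<Rightarrow> 'k \<Rightarrow> 'k \<Rightarrow> bool" where
  "on_curve W x y \<longleftrightarrow>
     y ^ 2 + wa1 W * x * y + wa3 W * y = x ^ 3 + wa2 W * x ^ 2 + wa4 W * x + wa6 W"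

definition singular_at :: "'k::field weierstrass \<Rightarrow> 'k \<Rightarrow> 'k \<Rightarrow> bool" where
  "singular_at W x y \<longleftrightarrow>
     wa1 W * y - 3 * x ^ 2 - 2 * wa2 W * x - wa4 W = 0 \<and> 2 * y + wa1 W * x + wa3 W = 0"

text \<open>
  The smooth locus: an elliptic curve if the discriminant is nonzero, and isomorphic to the
  multiplicative group in the nodal case over an algebraically closed field.
\<close>

definition smooth_points :: "'k::field weierstrass \<Rightarrow> 'k wpoint set" where
  "smooth_points W = insert Origin {Affine x y | x y. on_curve W x y \<and> \<not> singular_at W x y}"

definition chord_slope :: "'k::field weierstrass \<Rightarrow> 'k \<Rightarrow> 'k \<Rightarrow> 'k \<Rightarrow> 'k \<Rightarrow> 'k" where
  "chord_slope W x1 y1 x2 y2 =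
     (if x1 \<noteq> x2 then (y2 - y1) / (x2 - x1)
      else (3 * x1 ^ 2 + 2 * wa2 W * x1 + wa4 W - wa1 W * y1) / (2 * y1 + wa1 W * x1 + wa3 W))"

fun wadd :: "'k::field weierstrass \<Rightarrow> 'k wpoint \<Rightarrow> 'k wpoint \<Rightarrow> 'k wpoint" where
  "wadd W Origin Q = Q"
| "wadd W P Origin = P"
| "wadd W (Affine x1 y1) (Affine x2 y2) =
     (if x1 = x2 \<and> y1 + y2 + wa1 W * x2 + wa3 W = 0 then Origin
      else let l = chord_slope W x1 y1 x2 y2;
               x3 = l ^ 2 + wa1 W * l - wa2 W - x1 - x2
           in Affine x3 (l * (x1 - x3) - y1 - wa1 W * x3 - wa3 W))"

text \<open>
  \<open>W\<close> is a family of generalized elliptic curves indexed by \<open>I\<close>. The semi-abelian variety is the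
  product of their smooth loci; over an algebraically closed field this (reduced) variety is
  described by its set of rational points.
\<close>

definition semiabelian :: "'i set \<Rightarrow> ('i \<Rightarrow> 'k::field weierstrass) \<Rightarrow> ('i \<Rightarrow> 'k wpoint) set" where
  "semiabelian I W = (\<Pi>\<^sub>E i\<in>I. smooth_points (W i))"

definition semiabelian_add ::
  "'i set \<Rightarrow> ('i \<Rightarrow> 'k::field weierstrass) \<Rightarrow> ('i \<Rightarrow> 'k wpoint) \<Rightarrow> ('i \<Rightarrow> 'k wpoint) \<Rightarrow> ('i \<Rightarrow> 'k wpoint)"
  where "semiabelian_add I W P Q = (\<lambda>i\<in>I. wadd (W i) (P i) (Q i))"

definition semiabelian_zero :: "'i set \<Rightarrow> 'i \<Rightarrow> 'k wpoint" where
  "semiabelian_zero I = (\<lambda>i\<in>I. Origin)"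

text \<open>Homogeneous coordinates in the projective plane, indexed by \<open>0, 1, 2\<close>.\<close>

fun hcoord :: "'k::field wpoint \<Rightarrow> nat \<Rightarrow> 'k" where
  "hcoord Origin k = (if k = 1 then 1 else 0)"
| "hcoord (Affine x y) k = (if k = 0 then x else if k = 1 then y else 1)"

text \<open>
  Polynomial functions in one triple of homogeneous coordinates for each \<open>i \<in> I\<close> that are
  homogeneous of degree \<open>d i\<close> in the \<open>i\<close>-th triple.
\<close>

inductive multiform ::
  "'i set \<Rightarrow> ('i \<Rightarrow> nat) \<Rightarrow> (('i \<Rightarrow> nat \<Rightarrow> 'k::field) \<Rightarrow> 'k) \<Rightarrow> bool" for I :: "'i set" where
  const: "multiform I (\<lambda>_. 0) (\<lambda>_. c)"
| coord: "i \<in> I \<Longrightarrow> k < 3 \<Longrightarrow> multiform I ((\<lambda>_. 0)(i := 1)) (\<lambda>v. v i k)"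
| add: "multiform I d F \<Longrightarrow> multiform I d G \<Longrightarrow> multiform I d (\<lambda>v. F v + G v)"
| mult: "multiform I d F \<Longrightarrow> multiform I e G \<Longrightarrow> multiform I (\<lambda>i. d i + e i) (\<lambda>v. F v * G v)"

text \<open>
  A map from a subset \<open>A\<close> of a product of projective planes to a projective plane is regular if
  on some basic Zariski neighbourhood \<open>G \<noteq> 0\<close> of each point of \<open>A\<close> it is of the form
  \<open>[F 0 : F 1 : F 2]\<close> for multihomogeneous polynomials \<open>F k\<close> of a common multidegree.
\<close>

definition regular_map :: "'i set \<Rightarrow> ('i \<Rightarrow> 'k::field wpoint) set \<Rightarrow> (('i \<Rightarrow> 'k wpoint) \<Rightarrow> 'k wpoint) \<Rightarrow> bool"
  where
  "regular_map I A f \<longleftrightarrow>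
     (\<forall>P\<in>A. \<exists>d G e F. multiform I d G \<and> (\<forall>k<3. multiform I e (F k)) \<and>
        G (\<lambda>i. hcoord (P i)) \<noteq> 0 \<and>
        (\<forall>Q\<in>A. G (\<lambda>i. hcoord (Q i)) \<noteq> 0 \<longrightarrow>
           (\<exists>c. c \<noteq> 0 \<and> (\<forall>k<3. F k (\<lambda>i. hcoord (Q i)) = c * hcoord (f Q) k))))"

text \<open>
  An isogeny is a surjective homomorphism of algebraic groups with finite kernel; it may be
  inseparable.
\<close>

definition isogeny ::
  "'i set \<Rightarrow> ('i \<Rightarrow> 'k::alg_closed_field weierstrass) \<Rightarrow> ('i \<Rightarrow> 'k weierstrass)
     \<Rightarrow> (('i \<Rightarrow> 'k wpoint) \<Rightarrow> ('i \<Rightarrow> 'k wpoint)) \<Rightarrow> bool" where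
  "isogeny I W W' f \<longleftrightarrow>
     f ` semiabelian I W = semiabelian I W' \<and>
     (\<forall>i\<in>I. regular_map I (semiabelian I W) (\<lambda>P. f P i)) \<and>
     (\<forall>P\<in>semiabelian I W. \<forall>Q\<in>semiabelian I W.
        f (semiabelian_add I W P Q) = semiabelian_add I W' (f P) (f Q)) \<and>
     finite {P \<in> semiabelian I W. f P = semiabelian_zero I}"

text \<open>
  \<open>X(1)\<close> is the \<open>j\<close>-line, so a geometric point of \<open>X(1)^I\<close> is a family of points of the
  projective line. The corresponding semi-abelian variety is only defined up to isomorphism:
  over an algebraically closed field a generalized elliptic curve with given \<open>j\<close>-invariant is
  unique up to isomorphism, so the choice of \<open>W\<close> below is immaterial.
\<close>

definition parametrizes :: "'i set \<Rightarrow> ('i \<Rightarrow> 'k::alg_closed_field proj_line) \<Rightarrow> ('i \<Rightarrow> 'k weierstrass) \<Rightarrow> bool"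
  where
  "parametrizes I \<xi> W \<longleftrightarrow> (\<forall>i\<in>I. generalized_elliptic (W i) \<and> j_invariant (W i) = \<xi> i)"

definition geometrically_isogenous ::
  "'i set \<Rightarrow> ('i \<Rightarrow> 'k::alg_closed_field proj_line) \<Rightarrow> ('i \<Rightarrow> 'k proj_line) \<Rightarrow> bool" where
  "geometrically_isogenous I \<xi> \<eta> \<longleftrightarrow>
     (\<exists>W W' f. parametrizes I \<xi> W \<and> parametrizes I \<eta> W' \<and> isogeny I W W' f)"

text \<open>
  The closed points of a variety over a field \<open>F\<close> are the orbits of its geometric points over an
  algebraic closure under the automorphisms fixing \<open>F\<close>.
\<close>

definition field_auts :: "('f::field alg_closure \<Rightarrow> 'f alg_closure) set" where
  "field_auts = {\<sigma>. bij \<sigma> \<and> (\<forall>x y. \<sigma> (x + y) = \<sigma> x + \<sigma> y) \<and> (\<forall>x y. \<sigma> (x * y) = \<sigma> x * \<sigma> y) \<and>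
                    (\<forall>a. \<sigma> (to_ac a) = to_ac a)}"

definition closed_point ::
  "'i set \<Rightarrow> ('i \<Rightarrow> 'f::field alg_closure proj_line) \<Rightarrow> ('i \<Rightarrow> 'f alg_closure proj_line) set" where
  "closed_point I \<xi> = {(\<lambda>i\<in>I. map_proj_line \<sigma> (\<xi> i)) | \<sigma>. \<sigma> \<in> field_auts}"

text \<open>
  Points \<open>x\<close>, \<open>y\<close> with possibly different residue fields are compared over a common
  algebraically closed field, i.e. on some choice of geometric points above them.
\<close>

definition isogenous ::
  "'i set \<Rightarrow> ('i \<Rightarrow> 'f::field alg_closure proj_line) set \<Rightarrow> ('i \<Rightarrow> 'f alg_closure proj_line) set \<Rightarrow> bool" where
  "isogenous I x y \<longleftrightarrow> (\<exists>\<xi>\<in>x. \<exists>\<eta>\<in>y. geometrically_isogenous I \<xi> \<eta>)"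

fun translate :: "'k::field \<Rightarrow> 'k proj_line \<Rightarrow> 'k proj_line" where
  "translate b (Fin t) = Fin (t + b)"
| "translate b Infty = Infty"

text \<open>
  Closed points of the curves in \<open>X(1)^(n+1)\<close>. The generic points of the curves are omitted:
  each curve has only one, which does not affect whether a set of points is infinite, and it
  cannot be isogenous to a closed point.
\<close>

definition curve_C :: "nat \<Rightarrow> (nat \<Rightarrow> 'f::field) \<Rightarrow> (nat \<Rightarrow> 'f alg_closure proj_line) set set" where
  "curve_C n b = {closed_point {..n} (\<lambda>i\<in>{..n}. translate (to_ac (b i)) t) | t. True}"

definition diagonal :: "nat \<Rightarrow> (nat \<Rightarrow> 'f::field alg_closure proj_line) set set" where
  "diagonal n = {closed_point {..n} (\<lambda>i\<in>{..n}. s) | s. True}"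

text \<open>The image of the integers, which is the prime field in positive characteristic.\<close>

definition prime_subfield :: "'f::{field, finite} set" where
  "prime_subfield = range of_int"

end

theory Submission
  imports Defs
begin

text \<open>
  Write \<open>b i = b 0 + m i * c\<close> with \<open>m i\<close> in the prime field, and let \<open>Q\<close> be a power of \<open>p\<close>
  such that \<open>x \<mapsto> x ^ Q\<close> fixes \<open>\<F>\<^sub>q\<close>. A root \<open>u\<close> of \<open>X ^ Q - X - c\<close> satisfies
  \<open>u ^ (Q ^ e) = u + e * c\<close>, so the coordinates \<open>u + m i * c\<close> of the point of \<open>C\<close> at
  \<open>t = u - b 0\<close> are Frobenius conjugates of each other, and powers of Frobenius give an isogeny
  to the point \<open>(u, \<dots>, u)\<close> of the diagonal. Taking \<open>Q = q ^ (p ^ k)\<close> for all \<open>k\<close> gives infinitely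
  many closed points, because the corresponding \<open>u\<close> is fixed by the \<open>q ^ (p ^ l)\<close>-power map
  exactly when \<open>l > k\<close>.
\<close>

section \<open>Field automorphisms acting on Weierstrass curves\<close>

text \<open>Covers two kinds of maps: Frobenius powers on an algebraically closed field, and the
  automorphisms whose orbits are the closed points.\<close>

locale field_automorphism =
  fixes \<phi> :: "'k::field \<Rightarrow> 'k"
  assumes bij: "bij \<phi>"
    and hom_add [simp]: "\<phi> (x + y) = \<phi> x + \<phi> y"
    and hom_mult [simp]: "\<phi> (x * y) = \<phi> x * \<phi> y"
begin

lemma hom_eq_iff [simp]: "\<phi> x = \<phi> y \<longleftrightarrow> x = y"
  using bij by (auto simp: bij_def inj_eq)

lemma hom_0 [simp]: "\<phi> 0 = 0"
  using hom_add[of 0 0] unfolding add_0_left by (metis add_cancel_right_right)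

lemma hom_eq_0_iff [simp]: "\<phi> x = 0 \<longleftrightarrow> x = 0"
  using hom_eq_iff[of x 0] by (simp del: hom_eq_iff)

lemma hom_1 [simp]: "\<phi> 1 = 1"
  using hom_mult[of 1 1] by (simp del: hom_mult)

lemma hom_uminus [simp]: "\<phi> (- x) = - \<phi> x"
  using hom_add[of x "- x"] by (simp del: hom_add add: eq_neg_iff_add_eq_0 add.commute)

lemma hom_diff [simp]: "\<phi> (x - y) = \<phi> x - \<phi> y"
  using hom_add[of x "- y"] by (simp del: hom_add)

lemma hom_power [simp]: "\<phi> (x ^ n) = \<phi> x ^ n"
  by (induction n) auto

lemma hom_of_nat [simp]: "\<phi> (of_nat n) = of_nat n"
  by (induction n) auto

lemma hom_numeral [simp]: "\<phi> (numeral n) = numeral n"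
  using hom_of_nat[of "numeral n"] by (simp del: hom_of_nat)

text \<open>Division by 0 yields 0 on both sides, so \<open>chord_slope\<close> commutes with
  \<open>\<phi>\<close> even where its denominator vanishes.\<close>

lemma hom_divide [simp]: "\<phi> (x / y) = \<phi> x / \<phi> y"
proof (cases "y = 0")
  case False
  then have "\<phi> (x / y) * \<phi> y = \<phi> x"
    by (simp flip: hom_mult)
  with False show ?thesis
    by (simp add: field_simps)
qed auto

text \<open>For a Frobenius power \<open>\<phi>\<close> this is the usual Frobenius twist.\<close>

definition conj_curve :: "'k weierstrass \<Rightarrow> 'k weierstrass" where
  "conj_curve W = \<lparr>wa1 = \<phi> (wa1 W), wa2 = \<phi> (wa2 W), wa3 = \<phi> (wa3 W),
                   wa4 = \<phi> (wa4 W), wa6 = \<phi> (wa6 W)\<rparr>"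

lemma conj_curve_simps [simp]:
  "wa1 (conj_curve W) = \<phi> (wa1 W)" "wa2 (conj_curve W) = \<phi> (wa2 W)"
  "wa3 (conj_curve W) = \<phi> (wa3 W)" "wa4 (conj_curve W) = \<phi> (wa4 W)"
  "wa6 (conj_curve W) = \<phi> (wa6 W)"
  by (simp_all add: conj_curve_def)

lemma wc4_conj [simp]: "wc4 (conj_curve W) = \<phi> (wc4 W)"
  by (simp add: wc4_def wb2_def wb4_def)

lemma wdisc_conj [simp]: "wdisc (conj_curve W) = \<phi> (wdisc W)"
  by (simp add: wdisc_def wb2_def wb4_def wb6_def wb8_def)

lemma generalized_elliptic_conj [simp]:
  "generalized_elliptic (conj_curve W) \<longleftrightarrow> generalized_elliptic W"
  by (simp add: generalized_elliptic_def)

lemma j_invariant_conj [simp]: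
  "j_invariant (conj_curve W) = map_proj_line \<phi> (j_invariant W)"
  by (simp add: j_invariant_def)

lemma on_curve_conj [simp]: "on_curve (conj_curve W) (\<phi> x) (\<phi> y) \<longleftrightarrow> on_curve W x y"
  unfolding on_curve_def conj_curve_simps
  by (simp flip: hom_add hom_mult hom_power)

lemma singular_at_conj [simp]: "singular_at (conj_curve W) (\<phi> x) (\<phi> y) \<longleftrightarrow> singular_at W x y"
proof -
  have "wa1 (conj_curve W) * \<phi> y - 3 * \<phi> x ^ 2 - 2 * wa2 (conj_curve W) * \<phi> x - wa4 (conj_curve W)
      = \<phi> (wa1 W * y - 3 * x ^ 2 - 2 * wa2 W * x - wa4 W)"
    and "2 * \<phi> y + wa1 (conj_curve W) * \<phi> x + wa3 (conj_curve W)
      = \<phi> (2 * y + wa1 W * x + wa3 W)"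
    by simp_all
  then show ?thesis
    unfolding singular_at_def by (simp only: hom_eq_0_iff)
qed

text \<open>Injectivity transports the equation and nonsingularity; surjectivity makes every point
  of the twist an image.\<close>

lemma smooth_points_conj: "map_wpoint \<phi> ` smooth_points W = smooth_points (conj_curve W)"
proof (intro equalityI subsetI)
  fix P assume "P \<in> smooth_points (conj_curve W)"
  then consider "P = Origin"
    | x y where "P = Affine x y" "on_curve (conj_curve W) x y" "\<not> singular_at (conj_curve W) x y"
    by (auto simp: smooth_points_def)
  then show "P \<in> map_wpoint \<phi> ` smooth_points W"
  proof cases
    case 1
    then show ?thesis
      by (intro image_eqI[of _ _ Origin]) (auto simp: smooth_points_def)
  next
    case 2
    obtain x' y' where "x = \<phi> x'" "y = \<phi> y'"
      using bij by (metis bij_pointE)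
    with 2 show ?thesis
      by (intro image_eqI[of _ _ "Affine x' y'"]) (auto simp: smooth_points_def)
  qed
qed (auto simp: smooth_points_def)

lemma chord_slope_conj:
  "chord_slope (conj_curve W) (\<phi> x1) (\<phi> y1) (\<phi> x2) (\<phi> y2) = \<phi> (chord_slope W x1 y1 x2 y2)"
  by (simp add: chord_slope_def)

text \<open>The addition formulas are rational over the prime field, and their case distinctions
  test equalities, which an injective homomorphism preserves and reflects.\<close>

lemma wadd_conj:
  "map_wpoint \<phi> (wadd W P R) = wadd (conj_curve W) (map_wpoint \<phi> P) (map_wpoint \<phi> R)"
proof (cases P; cases R)
  fix x1 y1 x2 y2 assume [simp]: "P = Affine x1 y1" "R = Affine x2 y2"
  have "\<phi> y1 + \<phi> y2 + \<phi> (wa1 W) * \<phi> x2 + \<phi> (wa3 W) = \<phi> (y1 + y2 + wa1 W * x2 + wa3 W)"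
    by simp
  then have "\<phi> y1 + \<phi> y2 + \<phi> (wa1 W) * \<phi> x2 + \<phi> (wa3 W) = 0 \<longleftrightarrow> y1 + y2 + wa1 W * x2 + wa3 W = 0"
    by (simp only: hom_eq_0_iff)
  then show ?thesis
    by (simp add: Let_def chord_slope_conj)
qed auto

lemma hcoord_map: "hcoord (map_wpoint \<phi> P) k = \<phi> (hcoord P k)"
  by (cases P) auto

lemma map_wpoint_eq_Origin_iff [simp]: "map_wpoint \<phi> P = Origin \<longleftrightarrow> P = Origin"
  by (cases P) auto

end

section \<open>The Frobenius isogeny\<close>

lemma multiform_coord_power:
  assumes "i \<in> I" "k < 3"
  shows "multiform I (\<lambda>j. if j = i then N else 0) (\<lambda>v :: _ \<Rightarrow> _ \<Rightarrow> 'k::field. v i k ^ N)"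
proof (induction N)
  case 0
  then show ?case
    using multiform.const[of I 1] by simp
next
  case (Suc N)
  from multiform.mult[OF multiform.coord[OF assms] this]
  have "multiform I (\<lambda>j. ((\<lambda>_. 0)(i := 1)) j + (if j = i then N else 0))
      (\<lambda>v :: _ \<Rightarrow> _ \<Rightarrow> 'k. v i k ^ Suc N)"
    unfolding power_Suc .
  also have "(\<lambda>j. ((\<lambda>_. 0)(i := 1)) j + (if j = i then N else 0)) = (\<lambda>j. if j = i then Suc N else 0)"
    by auto
  finally show ?case .
qed

text \<open>The exponent may vary with the factor. Bijectivity on coordinates gives surjectivity and
  a trivial kernel on geometric points.\<close>

lemma isogeny_frobenius:
  fixes W :: "'i \<Rightarrow> 'k::alg_closed_field weierstrass" and N :: "'i \<Rightarrow> nat"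
  defines "\<phi> \<equiv> \<lambda>i x. x ^ N i"
  assumes aut: "\<And>i. i \<in> I \<Longrightarrow> field_automorphism (\<phi> i)"
  shows "isogeny I W (\<lambda>i. field_automorphism.conj_curve (\<phi> i) (W i))
           (\<lambda>P. \<lambda>i\<in>I. map_wpoint (\<phi> i) (P i))"
    (is "isogeny I W ?W' ?f")
proof -
  have img: "map_wpoint (\<phi> i) ` smooth_points (W i) = smooth_points (?W' i)" if "i \<in> I" for i
    using field_automorphism.smooth_points_conj[OF aut[OF that]] .
  have "?f ` semiabelian I W = semiabelian I ?W'"
  proof (intro equalityI subsetI)
    fix R assume "R \<in> ?f ` semiabelian I W"
    then show "R \<in> semiabelian I ?W'"
      using img unfolding semiabelian_def by (fastforce simp: PiE_iff)
  next
    fix R assume R: "R \<in> semiabelian I ?W'"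
    then have "\<forall>i\<in>I. \<exists>P \<in> smooth_points (W i). R i = map_wpoint (\<phi> i) P"
      using img unfolding semiabelian_def by (fastforce simp: PiE_iff)
    then obtain P where P: "\<And>i. i \<in> I \<Longrightarrow> P i \<in> smooth_points (W i) \<and> R i = map_wpoint (\<phi> i) (P i)"
      by metis
    have "R = ?f (restrict P I)"
      using R P unfolding semiabelian_def by (intro ext) (auto simp: PiE_iff extensional_def)
    moreover have "restrict P I \<in> semiabelian I W"
      using P by (auto simp: semiabelian_def)
    ultimately show "R \<in> ?f ` semiabelian I W"
      by blast
  qed
  moreover have "regular_map I (semiabelian I W) (\<lambda>P. ?f P i)" if i: "i \<in> I" for i
    unfolding regular_map_def
  proof
    fix P assume "P \<in> semiabelian I W"
    show "\<exists>d G e F. multiform I d G \<and> (\<forall>k<3. multiform I e (F k)) \<and>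
            G (\<lambda>i. hcoord (P i)) \<noteq> 0 \<and>
            (\<forall>R\<in>semiabelian I W. G (\<lambda>i. hcoord (R i)) \<noteq> 0 \<longrightarrow>
               (\<exists>c. c \<noteq> 0 \<and> (\<forall>k<3. F k (\<lambda>i. hcoord (R i)) = c * hcoord (?f R i) k)))"
      \<comment> \<open>One formula works everywhere: \<open>G = 1\<close>, the
        \<open>N i\<close>-th powers of the three coordinates of factor \<open>i\<close>, and the
        scalar 1.\<close>
      by (rule exI[of _ "\<lambda>_. 0"], rule exI[of _ "\<lambda>_. 1"],
          rule exI[of _ "\<lambda>j. if j = i then N i else 0"], rule exI[of _ "\<lambda>k v. v i k ^ N i"])
        (use i in \<open>auto intro!: multiform.const multiform_coord_power exI[of _ 1]
           simp: field_automorphism.hcoord_map[OF aut[OF i]]\<close>, simp add: \<phi>_def)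
  qed
  moreover have "?f (semiabelian_add I W P R) = semiabelian_add I ?W' (?f P) (?f R)" for P R
    by (auto simp: semiabelian_add_def fun_eq_iff field_automorphism.wadd_conj[OF aut])
  moreover have "{P \<in> semiabelian I W. ?f P = semiabelian_zero I} \<subseteq> {semiabelian_zero I}"
  proof safe
    fix P assume P: "P \<in> semiabelian I W" and "?f P = semiabelian_zero I"
    then have "map_wpoint (\<phi> i) (P i) = Origin" if "i \<in> I" for i
      using that by (auto simp: semiabelian_zero_def dest!: fun_cong[of _ _ i])
    with P show "P = semiabelian_zero I"
      by (intro ext) (auto simp: semiabelian_def semiabelian_zero_def PiE_iff extensional_def
        field_automorphism.map_wpoint_eq_Origin_iff[OF aut])
  qed
  then have "finite {P \<in> semiabelian I W. ?f P = semiabelian_zero I}"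
    by (rule finite_subset) simp
  ultimately show ?thesis
    unfolding isogeny_def by blast
qed

text \<open>Additivity is the freshman's dream; it reduces injectivity to the absence of nilpotents.
  Surjectivity is the existence of roots.\<close>

lemma field_automorphism_frobenius:
  assumes "prime CHAR('k::alg_closed_field)"
  shows "field_automorphism (\<lambda>x::'k. x ^ (CHAR('k) ^ e))"
proof
  have pos: "CHAR('k) ^ e > 0"
    using assms prime_gt_0_nat by simp
  show add: "(x + y) ^ (CHAR('k) ^ e) = x ^ (CHAR('k) ^ e) + y ^ (CHAR('k) ^ e)" for x y :: 'k
    using freshmans_dream'[OF assms refl] .
  show "bij (\<lambda>x::'k. x ^ (CHAR('k) ^ e))"
  proof (rule bijI)
    show "inj (\<lambda>x::'k. x ^ (CHAR('k) ^ e))"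
    proof (rule injI)
      fix x y :: 'k assume "x ^ (CHAR('k) ^ e) = y ^ (CHAR('k) ^ e)"
      with add[of "x - y" y] have "(x - y) ^ (CHAR('k) ^ e) = 0"
        by simp
      then show "x = y"
        by simp
    qed
    show "surj (\<lambda>x::'k. x ^ (CHAR('k) ^ e))"
      using nth_root_exists[OF pos] by (metis surjI)
  qed
qed (simp add: power_mult_distrib)

text \<open>The model \<open>y^2 + x y = x^3 - 36/(j - 1728) x - 1/(j - 1728)\<close> has
  \<open>c4 = j/(j - 1728)\<close> and discriminant \<open>j^2/(j - 1728)^3\<close> in every
  characteristic. It breaks down exactly at the two excluded values.\<close>

lemma ex_weierstrass_j:
  fixes j :: "'k::field"
  assumes "j \<noteq> 0" "j \<noteq> 1728"
  shows "\<exists>W. generalized_elliptic W \<and> j_invariant W = Fin j"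
proof -
  define d where "d = j - 1728"
  have [simp]: "d \<noteq> 0" and j: "j = d + 1728"
    using assms by (auto simp: d_def)
  define W where "W = \<lparr>wa1 = 1, wa2 = 0, wa3 = 0, wa4 = - 36 / d, wa6 = - 1 / d\<rparr>"
  have c4: "wc4 W = j / d"
    by (simp add: W_def wc4_def wb2_def wb4_def j field_simps)
  have disc: "wdisc W = j ^ 2 / d ^ 3"
    by (simp add: W_def wdisc_def wb2_def wb4_def wb6_def wb8_def j field_simps power2_eq_square
        power3_eq_cube)
  have "wc4 W ^ 3 / wdisc W = j"
    using assms(1) by (simp add: c4 disc power2_eq_square power3_eq_cube)
  then show ?thesis
    using assms(1) by (intro exI[of _ W]) (simp add: generalized_elliptic_def j_invariant_def disc)
qed

text \<open>The j-invariant is a rational function of the coefficients, so twisting by a Frobenius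
  power raises it to that same power.\<close>

lemma geometrically_isogenous_frobenius:
  fixes u :: "'i \<Rightarrow> 'k::alg_closed_field"
  assumes "prime CHAR('k)"
    and "\<And>i. i \<in> I \<Longrightarrow> u i \<noteq> 0 \<and> u i \<noteq> 1728"
    and "\<And>i. i \<in> I \<Longrightarrow> u i ^ (CHAR('k) ^ e i) = s i"
  shows "geometrically_isogenous I (\<lambda>i\<in>I. Fin (u i)) (\<lambda>i\<in>I. Fin (s i))"
proof -
  have "\<forall>i\<in>I. \<exists>W. generalized_elliptic W \<and> j_invariant W = Fin (u i)"
    using ex_weierstrass_j assms(2) by blast
  from bchoice[OF this] obtain W
    where W: "\<And>i. i \<in> I \<Longrightarrow> generalized_elliptic (W i) \<and> j_invariant (W i) = Fin (u i)"
    by blast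
  note aut = field_automorphism_frobenius[OF assms(1)]
  have "parametrizes I (\<lambda>i\<in>I. Fin (u i)) W"
    using W by (simp add: parametrizes_def)
  moreover have "parametrizes I (\<lambda>i\<in>I. Fin (s i))
      (\<lambda>i. field_automorphism.conj_curve (\<lambda>x. x ^ (CHAR('k) ^ e i)) (W i))"
    using W assms(3)
    by (simp add: parametrizes_def field_automorphism.generalized_elliptic_conj[OF aut]
        field_automorphism.j_invariant_conj[OF aut])
  ultimately show ?thesis
    unfolding geometrically_isogenous_def using isogeny_frobenius[OF aut] by blast
qed

section \<open>Artin--Schreier points\<close>

lemma prime_CHAR_finite: "prime CHAR('f::{field, finite})"
  using finite_imp_CHAR_pos[where 'a = 'f] by (intro prime_CHAR_semidom) auto

lemma ex_frobenius_trivial: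
  "\<exists>r>0. \<forall>x::'f::{field, finite}. x ^ (CHAR('f) ^ r) = x"
proof -
  define F where "F = (\<lambda>x::'f. x ^ CHAR('f))"
  note p = prime_CHAR_finite[where 'f = 'f]
  have pow: "(F ^^ r) x = x ^ (CHAR('f) ^ r)" for r x
    by (induction r) (simp_all add: F_def power_mult [symmetric] mult.commute)
  have "inj F"
  proof (rule injI)
    fix x y assume "F x = F y"
    with freshmans_dream[OF p refl, of "x - y" y] have "(x - y) ^ CHAR('f) = 0"
      by (simp add: F_def)
    then show "x = y"
      by simp
  qed
  \<comment> \<open>Composition with \<open>F\<close> permutes the finite type of self-maps, so the
    orbit of \<open>id\<close> returns to \<open>id\<close>; this gives one exponent for all
    \<open>x\<close> at once.\<close>
  then have "inj ((\<circ>) F :: ('f \<Rightarrow> 'f) \<Rightarrow> _)"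
    by (auto simp: inj_def fun_eq_iff)
  then obtain r where r: "r > 0" "(((\<circ>) F) ^^ r) id = id"
    using funpow_inj_finite[of "(\<circ>) F" id] by auto
  have "(((\<circ>) F) ^^ r) id = F ^^ r" for r
    by (induction r) auto
  with r show ?thesis
    by (metis pow id_apply)
qed

lemma ex_artin_schreier_root:
  fixes c :: "'k::alg_closed_field"
  assumes "Q > 1"
  shows "\<exists>u. u ^ Q = u + c"
proof -
  have "degree (monom 1 Q + - [:c, 1:]) = Q"
    using assms by (subst degree_add_eq_left) (auto simp: degree_monom_eq)
  then obtain u where "poly (monom 1 Q + - [:c, 1:]) u = 0"
    using alg_closed_imp_poly_has_root assms by (metis less_trans zero_less_one)
  then show ?thesis
    by (auto simp: poly_monom algebra_simps intro!: exI[of _ u])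
qed

text \<open>The \<open>Q\<close>-power map is additive and fixes \<open>c\<close> and the images of
  the naturals, so each application adds \<open>c\<close> once more.\<close>

lemma artin_schreier_iterate:
  fixes u c :: "'k::comm_semiring_1"
  assumes "prime CHAR('k)" "Q = CHAR('k) ^ r" "u ^ Q = u + c" "c ^ Q = c"
  shows "u ^ (Q ^ e) = u + of_nat e * c"
proof (induction e)
  case (Suc e)
  have "of_nat e ^ Q = (of_nat e :: 'k)"
  proof (induction e)
    case 0
    then show ?case
      using prime_gt_0_nat[OF assms(1)] by (simp add: assms(2) power_0_left)
  next
    case (Suc e)
    then show ?case
      using freshmans_dream'[OF assms(1,2), of 1 "of_nat e"] by simp
  qed
  then have "(u + of_nat e * c) ^ Q = u + c + of_nat e * c"
    by (simp add: freshmans_dream'[OF assms(1,2)] power_mult_distrib assms(3,4))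
  moreover have "u ^ (Q ^ Suc e) = (u + of_nat e * c) ^ Q"
    by (simp only: power_Suc2 power_mult Suc)
  ultimately show ?case
    by (simp add: algebra_simps)
qed simp

text \<open>Prime field elements come as integers, but Frobenius is iterated a natural number of
  times; reduction modulo the characteristic bridges the two.\<close>

lemma ex_of_nat_eq_of_int:
  assumes "CHAR('a::ring_1) > 0"
  shows "\<exists>e. of_nat e = (of_int z :: 'a)"
proof -
  have "of_int z = (of_int (z mod int CHAR('a)) + of_nat CHAR('a) * of_int (z div int CHAR('a)) :: 'a)"
    by (metis mod_mult_div_eq of_int_add of_int_mult of_int_of_nat_eq)
  also have "\<dots> = of_nat (nat (z mod int CHAR('a)))"
    using assms by (simp add: of_nat_CHAR of_nat_nat)
  finally show ?thesis
    by metis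
qed

section \<open>Infinitely many Artin-Schreier points on \<open>C\<close>\<close>

theorem theorem3:
  fixes n :: nat and b :: "nat \<Rightarrow> 'f::{field, finite}"
  assumes "n \<ge> 1"
    and "inj_on b {..n}"
    and "\<forall>i\<in>{1..n}. \<forall>j\<in>{1..n}. (b i - b 0) / (b j - b 0) \<in> prime_subfield"
  shows "infinite {x \<in> curve_C n b. \<exists>y \<in> diagonal n. isogenous {..n} x y}"
proof -
  define p where "p = CHAR('f)"
  have p: "prime p"
    by (simp add: p_def prime_CHAR_finite)
  have pK: "prime CHAR('f alg_closure)"
    using p by (simp add: p_def)
  \<comment> \<open>Reference difference: taking \<open>j = 1\<close> in the hypothesis makes each
    \<open>b i - b 0\<close> a prime field multiple of \<open>c\<close>.\<close>
  define c where "c = b 1 - b 0"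
  have c: "c \<noteq> 0"
    using assms(1,2) by (auto simp: c_def inj_on_def)
  obtain r where r: "r > 0" "\<And>x::'f. x ^ (p ^ r) = x"
    using ex_frobenius_trivial[where 'f = 'f] by (auto simp: p_def)

  \<comment> \<open>\<open>e\<close> counts the \<open>Q\<close>-power steps that carry
    \<open>u + (b i - b 0)\<close> back to \<open>u\<close>, hence the sign in \<open>- z\<close>
    below.\<close>
  have "\<exists>e. b i + of_nat e * c = b 0" if "i \<le> n" for i
  proof (cases "i = 0")
    case False
    with that assms(1,3) have "(b i - b 0) / c \<in> prime_subfield"
      by (simp add: c_def)
    then obtain z where "(b i - b 0) / c = of_int z"
      by (auto simp: prime_subfield_def)
    moreover obtain e where "of_nat e = (of_int (- z) :: 'f)"
      using ex_of_nat_eq_of_int[where 'a = 'f, of "- z"] p prime_gt_0_nat by (auto simp: p_def)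
    ultimately show ?thesis
      using c by (intro exI[of _ e]) (simp add: field_simps)
  qed (auto intro: exI[of _ 0])
  then obtain e where e: "\<And>i. i \<le> n \<Longrightarrow> b i + of_nat (e i) * c = b 0"
    by metis

  \<comment> \<open>\<open>Q k\<close> is a power of \<open>p ^ r\<close>, so its power map fixes
    the base field; moreover \<open>Q (Suc k) = Q k ^ p\<close>.\<close>
  define Q where "Q k = p ^ (r * p ^ k)" for k
  have Q: "Q k = CHAR('f alg_closure) ^ (r * p ^ k)" for k
    by (simp add: Q_def p_def)
  have Q_gt_1: "Q k > 1" for k
    unfolding Q_def using prime_gt_1_nat[OF p] r(1) by (intro one_less_power) auto
  have fixed: "to_ac x ^ Q k = to_ac x" for x :: 'f and k
  proof -
    have "x ^ ((p ^ r) ^ m) = x" for m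
      by (induction m) (simp_all add: power_mult r(2))
    then show ?thesis
      by (simp add: Q_def power_mult flip: to_ac_power)
  qed
  have "\<exists>u. u ^ Q k = u + to_ac c" for k
    by (rule ex_artin_schreier_root[OF Q_gt_1])
  then obtain u where u: "\<And>k. u k ^ Q k = u k + to_ac c"
    by metis
  note add_power = freshmans_dream'[where 'a = "'f alg_closure", OF pK Q]
  have iter: "u k ^ (Q k ^ m) = u k + of_nat m * to_ac c" for k m
    using artin_schreier_iterate[OF pK Q u fixed] .
  \<comment> \<open>After \<open>p\<close> steps the total shift is \<open>p * c = 0\<close>, so
    \<open>u k\<close> is fixed by the power \<open>Q k ^ p = Q (Suc k)\<close>, and
    \<open>Q l\<close> is a power of that number.\<close>
  have periodic: "u k ^ Q l = u k" if "k < l" for k l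
  proof -
    have step: "u k ^ (Q k ^ p) = u k"
      using iter[of k p] of_nat_CHAR[where 'a = "'f alg_closure"] by (simp add: p_def)
    have *: "u k ^ ((Q k ^ p) ^ m) = u k" for m
      by (induction m) (simp_all add: power_mult step)
    obtain d where "l = Suc (k + d)"
      using less_imp_Suc_add \<open>k < l\<close> by blast
    then have "Q l = (Q k ^ p) ^ (p ^ d)"
      by (simp add: Q_def power_add mult_ac flip: power_mult)
    with * show ?thesis
      by metis
  qed

  define Y where
    "Y k = closed_point {..n} (\<lambda>i\<in>{..n}. translate (to_ac (b i)) (Fin (u k - to_ac (b 0))))" for k
  have id_aut: "id \<in> (field_auts :: ('f alg_closure \<Rightarrow> _) set)"
    by (simp add: field_auts_def)
  have mem: "(\<lambda>i\<in>{..n}. x i) \<in> closed_point {..n} (\<lambda>i\<in>{..n}. x i)"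
    for x :: "nat \<Rightarrow> 'f alg_closure proj_line"
    unfolding closed_point_def
    by (intro CollectI exI[of _ id] conjI id_aut) (auto simp: fun_eq_iff proj_line.map_id)

  have "Y k \<in> {x \<in> curve_C n b. \<exists>y \<in> diagonal n. isogenous {..n} x y}" for k
  proof -
    define v where "v i = u k + to_ac (b i - b 0)" for i
    \<comment> \<open>Translating by a base field element keeps a root of the Artin-Schreier
      equation.\<close>
    have v: "v i ^ Q k = v i + to_ac c" for i
      by (simp add: v_def add_power u fixed del: to_ac_diff)
    \<comment> \<open>Base field elements satisfy \<open>x ^ Q k = x\<close>, whereas
      \<open>v i\<close> is shifted by \<open>c \<noteq> 0\<close>. In particular the j-invariants 0
      and 1728 are avoided.\<close>
    have "v i \<noteq> to_ac x" for i x
      using v[of i] fixed[of x k] c by auto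
    from this[of _ 0] this[of _ 1728] have "v i \<noteq> 0 \<and> v i \<noteq> 1728" for i
      by simp
    moreover have "v i ^ (CHAR('f alg_closure) ^ (r * p ^ k * e i)) = u k" if "i \<in> {..n}" for i
    proof -
      have "v i ^ (Q k ^ e i) = v i + of_nat (e i) * to_ac c"
        using artin_schreier_iterate[OF pK Q v fixed] .
      also have "\<dots> = u k + to_ac (b i + of_nat (e i) * c) - to_ac (b 0)"
        by (simp add: v_def)
      also have "\<dots> = u k"
        using e that by (simp del: to_ac_add)
      finally show ?thesis
        by (simp add: Q_def p_def power_mult)
    qed
    ultimately have "geometrically_isogenous {..n} (\<lambda>i\<in>{..n}. Fin (v i)) (\<lambda>i\<in>{..n}. Fin (u k))"
      using pK by (intro geometrically_isogenous_frobenius) auto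
    moreover have "(\<lambda>i\<in>{..n}. translate (to_ac (b i)) (Fin (u k - to_ac (b 0)))) = (\<lambda>i\<in>{..n}. Fin (v i))"
      by (auto simp: v_def)
    ultimately have "isogenous {..n} (Y k) (closed_point {..n} (\<lambda>i\<in>{..n}. Fin (u k)))"
      unfolding isogenous_def Y_def using mem by metis
    moreover have "Y k \<in> curve_C n b"
      unfolding Y_def curve_C_def by blast
    moreover have "closed_point {..n} (\<lambda>i\<in>{..n}. Fin (u k)) \<in> diagonal n"
      unfolding diagonal_def by blast
    ultimately show ?thesis
      by blast
  qed
  moreover have "inj Y"
  proof (rule linorder_injI)
    fix k l :: nat assume "k < l"
    show "Y k \<noteq> Y l"
    proof
      assume "Y k = Y l"
      with mem have "(\<lambda>i\<in>{..n}. translate (to_ac (b i)) (Fin (u l - to_ac (b 0)))) \<in> Y k"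
        by (simp add: Y_def)
      then obtain \<sigma> where \<sigma>: "\<sigma> \<in> field_auts" "(\<lambda>i\<in>{..n}. translate (to_ac (b i)) (Fin (u l - to_ac (b 0)))) =
          (\<lambda>i\<in>{..n}. map_proj_line \<sigma> ((\<lambda>i\<in>{..n}. translate (to_ac (b i)) (Fin (u k - to_ac (b 0)))) i))"
        unfolding Y_def closed_point_def by blast
      \<comment> \<open>In coordinate 0 the translation by \<open>b 0\<close> cancels, leaving the
        parameter itself.\<close>
      from fun_cong[OF \<sigma>(2), of 0] have "u l = \<sigma> (u k)"
        by simp
      moreover interpret field_automorphism \<sigma>
        using \<sigma>(1) by unfold_locales (auto simp: field_auts_def)
      \<comment> \<open>Conjugation preserves being fixed by the \<open>Q l\<close>-power map, but
        that map moves \<open>u l\<close> by \<open>c \<noteq> 0\<close>.\<close>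
      have "\<sigma> (u k) ^ Q l = \<sigma> (u k)"
        using periodic[OF \<open>k < l\<close>] by (simp flip: hom_power)
      ultimately show False
        using u[of l] c by simp
    qed
  qed
  ultimately show ?thesis
    by (meson image_subsetI infinite_super range_inj_infinite)
qed

end
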